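(* Let $V=\{1,\dots,k\}$ be a finite metric space with distances $\ell_{i,j}$ and let $s$ be a current supply vector. Let $d=\langle d_1,\dots,d_k\rangle$ be the demand vector and let $\alpha=\langle\alpha_1,\dots,\alpha_k\rangle$ be a target supply vector, subject to the restriction that if $\alpha_i>0$ then $d_i>0$. Then there exist surge prices $\bar r$ for which some passenger-taxicab equilibrium induces supply $\alpha$ (i.e. $\bar r$ is in passenger-taxicab equilibrium for current supply $s$, demand $d$ and new supply $s'=\alpha$).
   Context: Supply and demand vectors are vectors in $[0,1]^{V}$ whose entries sum to $1$. A flow from $s$ to $s'$ is a function $f:V\times V\to\mathbb{R}^{\ge 0}$ with $\sum_{u} f(u,v)=s'_v$ for all $v$ and $\sum_v f(u,v)=s_u$ for all $u$. Its cost is $\sum_{u,v} f(u,v)\ell_{u,v}$; a min cost flow from $s$ to $s'$ is a flow of minimum cost. Surge prices are a vector $r\in(\mathbb{R}^{\ge 0})^V$. Given new supply $s'$, surge prices $r$ and demand $d$, the utility of an infinitesimal taxicab that switches from $u$ to $v$ is $$\mu(u\mapsto v\mid s',r,d)=r_v\cdot\frac{\min(s'_v,d_v)}{s'_v}-\ell_{u,v}.$$ Convention when $s'_v=0$: the fraction is taken to be $1$ if $d_v>0$ and $0$ if $d_v=0$. Given $s$, $d$ and $s'$, surge prices $r$ are in passenger-taxicab equilibrium if for every min cost flow $f$ from $s$ to $s'$ and all $u,v\in V$ with $f(u,v)>0$ we have $\mu(u\mapsto v\mid s',r,d)=\max_{w\in V}\mu(u\mapsto w\mid s',r,d)$. Such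 an equilibrium is said to induce supply $s'$. *)

theory Defs
  imports "HOL-Analysis.Analysis"
begin

text \<open>
  The finite metric space V is rendered as an arbitrary finite index type
  (so that k = CARD('v)) together with a distance function l satisfying
  Metric_space UNIV l.
\<close>

definition distribution_vector :: "real ^ 'v::finite \<Rightarrow> bool" where
  "distribution_vector x \<longleftrightarrow>
     (\<forall>v. x $ v \<in> {0..1}) \<and> (\<Sum>v\<in>UNIV. x $ v) = 1"

definition surge_prices :: "real ^ 'v::finite \<Rightarrow> bool" where
  "surge_prices r \<longleftrightarrow> (\<forall>v. 0 \<le> r $ v)"

definition is_flow ::
  "real ^ 'v::finite \<Rightarrow> real ^ 'v \<Rightarrow> ('v \<Rightarrow> 'v \<Rightarrow> real) \<Rightarrow> bool" where
  "is_flow s s' f \<longleftrightarrow>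
     (\<forall>u v. 0 \<le> f u v) \<and>
     (\<forall>v. (\<Sum>u\<in>UNIV. f u v) = s' $ v) \<and>
     (\<forall>u. (\<Sum>v\<in>UNIV. f u v) = s $ u)"

definition flow_cost ::
  "('v::finite \<Rightarrow> 'v \<Rightarrow> real) \<Rightarrow> ('v \<Rightarrow> 'v \<Rightarrow> real) \<Rightarrow> real" where
  "flow_cost l f = (\<Sum>u\<in>UNIV. \<Sum>v\<in>UNIV. f u v * l u v)"

definition min_cost_flow ::
  "('v::finite \<Rightarrow> 'v \<Rightarrow> real) \<Rightarrow> real ^ 'v \<Rightarrow> real ^ 'v \<Rightarrow> ('v \<Rightarrow> 'v \<Rightarrow> real) \<Rightarrow> bool" where
  "min_cost_flow l s s' f \<longleftrightarrow>
     is_flow s s' f \<and> (\<forall>g. is_flow s s' g \<longrightarrow> flow_cost l f \<le> flow_cost l g)"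

text \<open>
  The zero-supply convention has to be explicit: HOL division would give 0 for
  every fraction with denominator 0, also when there is positive demand.
\<close>

definition service_fraction :: "real \<Rightarrow> real \<Rightarrow> real" where
  "service_fraction x y =
     (if x = 0 then (if y > 0 then 1 else 0) else min x y / x)"

definition utility ::
  "('v::finite \<Rightarrow> 'v \<Rightarrow> real) \<Rightarrow> 'v \<Rightarrow> 'v \<Rightarrow> real ^ 'v \<Rightarrow> real ^ 'v \<Rightarrow> real ^ 'v \<Rightarrow> real" where
  "utility l u v s' r d = r $ v * service_fraction (s' $ v) (d $ v) - l u v"

definition passenger_taxicab_equilibrium ::
  "('v::finite \<Rightarrow> 'v \<Rightarrow> real) \<Rightarrow> real ^ 'v \<Rightarrow> real ^ 'v \<Rightarrow> real ^ 'v \<Rightarrow> real ^ 'v \<Rightarrow> bool" where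
  "passenger_taxicab_equilibrium l s d s' r \<longleftrightarrow>
     (\<forall>f. min_cost_flow l s s' f \<longrightarrow>
       (\<forall>u v. f u v > 0 \<longrightarrow>
          utility l u v s' r d = Max (range (\<lambda>w. utility l u w s' r d))))"

end

theory Submission
  imports Defs
begin

text \<open>
  The prices are dual potentials of the transportation problem. Fix a min cost flow \<open>f\<close> and one of
  its destinations \<open>v\<^sub>0\<close>. Let \<open>\<psi> w\<close> be the least marginal cost of moving one unit of supply from
  \<open>v\<^sub>0\<close> to \<open>w\<close> by rerouting \<open>f\<close>. Optimality of \<open>f\<close> makes this infimum finite at every destination,
  and appending one more rerouting step shows that every \<open>v\<close> used from \<open>u\<close> maximises
  \<open>\<psi> v - l u v\<close>. Complementary slackness carries this over to all other min cost flows. Finally,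
  \<open>\<psi>\<close> may be shifted by a large constant on the support of \<open>\<alpha>\<close>, which makes it nonnegative and
  makes the remaining vertices, priced at 0, unattractive.
\<close>

lemma flow_cost_add:
  "flow_cost l (\<lambda>u v. f u v + g u v) = flow_cost l f + flow_cost l g"
  by (simp add: flow_cost_def distrib_right sum.distrib)

lemma flow_cost_scale:
  "flow_cost l (\<lambda>u v. c * f u v) = c * flow_cost l f"
  by (simp add: flow_cost_def sum_distrib_left mult.assoc)

text \<open>Entries where \<open>f\<close> is positive tolerate a small negative change, and there
  are finitely many of them. So \<open>f + e * g\<close> is again a flow for some
  \<open>e > 0\<close>, and by linearity its cost exceeds that of \<open>f\<close> by exactly
  \<open>e * flow_cost l g\<close>.\<close>

lemma min_cost_flow_direction:
  fixes f g :: "'v::finite \<Rightarrow> 'v \<Rightarrow> real"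
  assumes f: "min_cost_flow l s s' f"
    and row: "\<And>u. (\<Sum>v\<in>UNIV. g u v) = 0"
    and col: "\<And>v. (\<Sum>u\<in>UNIV. g u v) = 0"
    and nonneg: "\<And>u v. f u v = 0 \<Longrightarrow> 0 \<le> g u v"
  shows "0 \<le> flow_cost l g"
proof -
  have flow: "is_flow s s' f"
    using f by (simp add: min_cost_flow_def)
  have "eventually (\<lambda>e. 0 \<le> f u v + e * g u v) (at_right 0)" for u v
  proof (cases "f u v = 0")
    case True
    then show ?thesis
      using nonneg[OF True] by (auto intro: eventually_mono[OF eventually_at_right_less])
  next
    case False
    then have "0 < f u v"
      using flow by (simp add: is_flow_def order_less_le)
    moreover have "((\<lambda>e. f u v + e * g u v) \<longlongrightarrow> f u v + 0 * g u v) (at_right 0)"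
      by (intro tendsto_intros)
    ultimately have "eventually (\<lambda>e. 0 < f u v + e * g u v) (at_right 0)"
      by (auto dest: order_tendstoD(1))
    then show ?thesis
      by (rule eventually_mono) simp
  qed
  then have "eventually (\<lambda>e. \<forall>u v. 0 \<le> f u v + e * g u v) (at_right 0)"
    by (intro eventually_all_finite)
  then have "eventually (\<lambda>e. 0 < e \<and> (\<forall>u v. 0 \<le> f u v + e * g u v)) (at_right (0::real))"
    using eventually_at_right_less by (rule eventually_conj[rotated])
  then obtain e where e: "0 < e" "\<And>u v. 0 \<le> f u v + e * g u v"
    using eventually_happens trivial_limit_at_right_real by blast
  have "is_flow s s' (\<lambda>u v. f u v + e * g u v)"
    using flow e row col by (simp add: is_flow_def sum.distrib flip: sum_distrib_left)
  then have "flow_cost l f \<le> flow_cost l (\<lambda>u v. f u v + e * g u v)"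
    using f by (simp add: min_cost_flow_def)
  also have "\<dots> = flow_cost l f + e * flow_cost l g"
    by (simp only: flow_cost_add flow_cost_scale)
  finally have "0 \<le> e * flow_cost l g"
    by simp
  then show ?thesis
    using \<open>0 < e\<close> by (simp add: zero_le_mult_iff)
qed

definition reroute :: "'v \<Rightarrow> 'v \<Rightarrow> 'v \<Rightarrow> 'v \<Rightarrow> 'v \<Rightarrow> real" where
  "reroute u v w = (\<lambda>a b. of_bool (a = u) * (of_bool (b = w) - of_bool (b = v)))"

lemma reroute_row: "(\<Sum>b\<in>UNIV. reroute u v w a b) = 0" for u v w a :: "'v::finite"
  by (simp add: reroute_def of_bool_def sum_subtractf flip: sum_distrib_left)

lemma reroute_col:
  "(\<Sum>a\<in>UNIV. reroute u v w a b) = of_bool (b = w) - of_bool (b = v)" for u v w b :: "'v::finite"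
  by (simp add: reroute_def of_bool_def flip: sum_distrib_right)

lemma flow_cost_reroute:
  "flow_cost l (reroute u v w) = l u w - l u v" for u v w :: "'v::finite"
proof -
  have "flow_cost l (reroute u v w)
      = (\<Sum>a\<in>UNIV. if a = u then \<Sum>b\<in>UNIV. (of_bool (b = w) - of_bool (b = v)) * l a b else 0)"
    unfolding flow_cost_def reroute_def by (intro sum.cong) auto
  also have "\<dots> = l u w - l u v"
    by (simp add: left_diff_distrib sum_subtractf of_bool_def if_distrib[of "\<lambda>x. x * _"] cong: if_cong)
  finally show ?thesis .
qed

lemma reroute_nonneg: "0 \<le> reroute u v w a b" if "(a, b) \<noteq> (u, v)"
  using that by (auto simp: reroute_def)

text \<open>First-order changes of \<open>f\<close>, the analogue of walks from \<open>v\<close> to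
  \<open>w\<close> in a residual graph. The sign condition is imposed only where \<open>f\<close>
  vanishes, instead of requiring \<open>f + g\<close> to be nonnegative; this makes changes
  composable by addition.\<close>

definition reroutings :: "('v::finite \<Rightarrow> 'v \<Rightarrow> real) \<Rightarrow> 'v \<Rightarrow> 'v \<Rightarrow> ('v \<Rightarrow> 'v \<Rightarrow> real) set" where
  "reroutings f v w = {g.
     (\<forall>a. (\<Sum>b\<in>UNIV. g a b) = 0) \<and>
     (\<forall>b. (\<Sum>a\<in>UNIV. g a b) = of_bool (b = w) - of_bool (b = v)) \<and>
     (\<forall>a b. f a b = 0 \<longrightarrow> 0 \<le> g a b)}"

lemma reroute_in_reroutings: "reroute u v w \<in> reroutings f v w" if "f u v \<noteq> 0"
  using that by (force simp: reroutings_def reroute_row reroute_col intro: reroute_nonneg)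

lemma reroutings_trans:
  assumes "g \<in> reroutings f x v" "h \<in> reroutings f v w"
  shows "(\<lambda>a b. g a b + h a b) \<in> reroutings f x w"
  using assms by (simp add: reroutings_def sum.distrib)

lemma min_cost_flow_potential:
  fixes f :: "'v::finite \<Rightarrow> 'v \<Rightarrow> real"
  assumes f: "min_cost_flow l s s' f"
  obtains \<psi> where "\<And>u v u' w. f u v \<noteq> 0 \<Longrightarrow> f u' w \<noteq> 0 \<Longrightarrow> \<psi> w - l u w \<le> \<psi> v - l u v"
proof (cases "\<exists>u v. f u v \<noteq> 0")
  case False
  then show ?thesis
    using that by blast
next
  case True
  then obtain u0 x where x: "f u0 x \<noteq> 0"
    by blast
  define \<psi> where "\<psi> w = (INF g\<in>reroutings f x w. flow_cost l g)" for w
  have bdd: "bdd_below (flow_cost l ` reroutings f x w)" if "f u' w \<noteq> 0" for u' w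
  proof (rule bdd_belowI2)
    fix g assume "g \<in> reroutings f x w"
    \<comment> \<open>Since \<open>f\<close> uses the pair \<open>(u', w)\<close>, the unit that
      \<open>g\<close> brought to \<open>w\<close> can be returned to \<open>x\<close>. The result
      preserves all row and column sums, so it is a feasible direction and cannot have negative
      cost.\<close>
    then have "(\<lambda>a b. g a b + reroute u' w x a b) \<in> reroutings f x x"
      using reroutings_trans reroute_in_reroutings[of f, OF that] by blast
    then have "0 \<le> flow_cost l (\<lambda>a b. g a b + reroute u' w x a b)"
      by (intro min_cost_flow_direction[OF f]) (simp_all add: reroutings_def)
    then show "l u' w - l u' x \<le> flow_cost l g"
      by (simp add: flow_cost_add flow_cost_reroute)
  qed
  have "\<psi> w - l u w \<le> \<psi> v - l u v" if uv: "f u v \<noteq> 0" and w: "f u' w \<noteq> 0" for u v u' w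
  proof -
    have "\<psi> w - (l u w - l u v) \<le> \<psi> v"
      unfolding \<psi>_def[of v]
    proof (rule cINF_greatest)
      show "reroutings f x v \<noteq> {}"
        using reroute_in_reroutings[of f, OF x] by blast
      fix g assume "g \<in> reroutings f x v"
      then have "(\<lambda>a b. g a b + reroute u v w a b) \<in> reroutings f x w"
        using reroutings_trans reroute_in_reroutings[of f, OF uv] by blast
      then have "\<psi> w \<le> flow_cost l (\<lambda>a b. g a b + reroute u v w a b)"
        unfolding \<psi>_def by (intro cINF_lower bdd[OF w])
      then show "\<psi> w - (l u w - l u v) \<le> flow_cost l g"
        by (simp add: flow_cost_add flow_cost_reroute)
    qed
    then show ?thesis
      by simp
  qed
  then show ?thesis
    using that by blast
qed

lemma is_flow_support: "0 < s' $ v \<longleftrightarrow> (\<exists>u. f u v \<noteq> 0)" if "is_flow s s' f"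
proof -
  have nonneg: "0 \<le> f u v" for u
    using that by (simp add: is_flow_def)
  have "s' $ v = (\<Sum>u\<in>UNIV. f u v)"
    using that by (simp add: is_flow_def)
  moreover have "0 \<le> (\<Sum>u\<in>UNIV. f u v)"
    by (simp add: nonneg sum_nonneg)
  ultimately show ?thesis
    using sum_nonneg_eq_0_iff[of UNIV "\<lambda>u. f u v"] nonneg by auto
qed

text \<open>The terms with \<open>M\<close> and \<open>\<phi>\<close> depend on the marginals alone,
  so the reduced costs of two flows from \<open>s\<close> to \<open>s'\<close> differ exactly as
  their costs do.\<close>

lemma flow_reduced_cost:
  assumes "is_flow s s' f"
  shows "(\<Sum>u\<in>UNIV. \<Sum>v\<in>UNIV. f u v * (M u - (\<phi> v - l u v)))
    = (\<Sum>u\<in>UNIV. s $ u * M u) - (\<Sum>v\<in>UNIV. s' $ v * \<phi> v) + flow_cost l f"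
proof -
  have "(\<Sum>u\<in>UNIV. \<Sum>v\<in>UNIV. f u v * M u) = (\<Sum>u\<in>UNIV. s $ u * M u)"
    using assms by (simp add: is_flow_def flip: sum_distrib_right)
  moreover have "(\<Sum>u\<in>UNIV. \<Sum>v\<in>UNIV. f u v * \<phi> v) = (\<Sum>v\<in>UNIV. s' $ v * \<phi> v)"
    using assms by (subst sum.swap) (simp add: is_flow_def flip: sum_distrib_right)
  ultimately show ?thesis
    by (simp add: flow_cost_def right_diff_distrib sum_subtractf)
qed

text \<open>With \<open>M\<close> the row maxima, \<open>f\<close> has reduced cost zero by
  \<open>opt\<close>. As \<open>g\<close> costs no more than \<open>f\<close>, its reduced cost is
  at most zero; being a sum of nonnegative terms, it vanishes term by term.\<close>

lemma complementary_slackness: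
  fixes f g :: "'v::finite \<Rightarrow> 'v \<Rightarrow> real"
  assumes f: "min_cost_flow l s s' f" and g: "min_cost_flow l s s' g"
    and opt: "\<And>u v w. f u v \<noteq> 0 \<Longrightarrow> \<phi> w - l u w \<le> \<phi> v - l u v"
    and uv: "g u v \<noteq> 0"
  shows "\<phi> v - l u v = Max (range (\<lambda>w. \<phi> w - l u w))"
proof -
  define M where "M u = Max (range (\<lambda>w. \<phi> w - l u w))" for u
  have M_ge: "\<phi> w - l u w \<le> M u" for u w
    by (simp add: M_def)
  have "M u = \<phi> v - l u v" if "f u v \<noteq> 0" for u v
    unfolding M_def using opt[OF that] by (intro Max_eqI) auto
  then have "(\<Sum>u\<in>UNIV. \<Sum>v\<in>UNIV. f u v * (M u - (\<phi> v - l u v))) = 0"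
    by (intro sum.neutral ballI) auto
  moreover have "is_flow s s' f" "is_flow s s' g" "flow_cost l g \<le> flow_cost l f"
    using f g by (auto simp: min_cost_flow_def)
  ultimately have "(\<Sum>u\<in>UNIV. \<Sum>v\<in>UNIV. g u v * (M u - (\<phi> v - l u v))) \<le> 0"
    using flow_reduced_cost[of s s' f M \<phi> l] flow_reduced_cost[of s s' g M \<phi> l] by simp
  moreover have nonneg: "0 \<le> g u v * (M u - (\<phi> v - l u v))" for u v
    using M_ge \<open>is_flow s s' g\<close> by (simp add: is_flow_def)
  ultimately have "(\<Sum>u\<in>UNIV. \<Sum>v\<in>UNIV. g u v * (M u - (\<phi> v - l u v))) = 0"
    by (intro antisym sum_nonneg) auto
  then have "g u v * (M u - (\<phi> v - l u v)) = 0"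
    using nonneg by (simp add: sum_nonneg_eq_0_iff sum_nonneg)
  then show ?thesis
    using uv by (simp add: M_def)
qed

theorem theorem3p9:
  fixes l :: "'v::finite \<Rightarrow> 'v \<Rightarrow> real"
    and s d \<alpha> :: "real ^ 'v"
  assumes "Metric_space UNIV l"
    and "distribution_vector s"
    and "distribution_vector d"
    and "distribution_vector \<alpha>"
    and "\<And>i. \<alpha> $ i > 0 \<Longrightarrow> d $ i > 0"
  shows "\<exists>r :: real ^ 'v. surge_prices r \<and> passenger_taxicab_equilibrium l s d \<alpha> r"
proof (cases "\<exists>f. min_cost_flow l s \<alpha> f")
  case False
  \<comment> \<open>The equilibrium condition quantifies over min cost flows, so here it holds
    vacuously.\<close>
  then have "passenger_taxicab_equilibrium l s d \<alpha> 0"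
    by (simp add: passenger_taxicab_equilibrium_def)
  moreover have "surge_prices (0 :: real ^ 'v)"
    by (simp add: surge_prices_def)
  ultimately show ?thesis
    by blast
next
  case True
  then obtain f where f: "min_cost_flow l s \<alpha> f"
    by blast
  then have flow: "is_flow s \<alpha> f"
    by (simp add: min_cost_flow_def)
  obtain \<psi> where \<psi>:
    "\<And>u v u' w. f u v \<noteq> 0 \<Longrightarrow> f u' w \<noteq> 0 \<Longrightarrow> \<psi> w - l u w \<le> \<psi> v - l u v"
    using min_cost_flow_potential[OF f] by metis
  \<comment> \<open>This shift makes \<open>\<psi> v + C - l u v\<close> nonnegative for every
    \<open>u\<close>, whereas an unsupplied \<open>w\<close> priced at 0 yields only
    \<open>- l u w\<close>. Comparisons between supplied vertices are unaffected by a common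
    constant.\<close>
  define C where "C = Max (range (\<lambda>(u, v). l u v - \<psi> v))"
  have "l u v - \<psi> v \<le> C" for u v
    unfolding C_def by (rule Max_ge) (auto intro: image_eqI[of _ _ "(u, v)"])
  then have C: "l u v \<le> \<psi> v + C" for u v
    by (simp add: algebra_simps)
  have l_nonneg: "0 \<le> l u v" for u v
    using assms(1) by (rule Metric_space.nonneg)
  define \<phi> where "\<phi> v = (if 0 < \<alpha> $ v then \<psi> v + C else 0)" for v
  have \<phi>_nonneg: "0 \<le> \<phi> v" for v
    using C[of v v] l_nonneg[of v v] by (simp add: \<phi>_def)
  have opt: "\<phi> w - l u w \<le> \<phi> v - l u v" if uv: "f u v \<noteq> 0" for u v w
  proof -
    have v: "0 < \<alpha> $ v"
      using is_flow_support[OF flow] uv by blast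
    show ?thesis
    proof (cases "0 < \<alpha> $ w")
      case True
      then show ?thesis
        using \<psi>[OF uv] is_flow_support[OF flow] v by (auto simp: \<phi>_def)
    next
      case False
      then show ?thesis
        using C[of u v] l_nonneg[of u w] v by (simp add: \<phi>_def)
    qed
  qed
  \<comment> \<open>Dividing by the service fraction turns the gross revenue into
    \<open>\<phi>\<close>. On the support of \<open>\<alpha>\<close> positive demand makes the
    fraction positive; elsewhere \<open>\<phi> v = 0\<close>, so the price is 0 even if the fraction
    is 0.\<close>
  define r :: "real ^ 'v" where "r = (\<chi> v. \<phi> v / service_fraction (\<alpha> $ v) (d $ v))"
  have frac_pos: "0 < service_fraction (\<alpha> $ v) (d $ v)" if "0 < \<alpha> $ v" for v
    using that assms(5)[OF that] by (simp add: service_fraction_def)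
  have r_eq: "r $ v * service_fraction (\<alpha> $ v) (d $ v) = \<phi> v" for v
    using frac_pos[of v] by (cases "0 < \<alpha> $ v") (simp_all add: r_def \<phi>_def)
  have "0 \<le> r $ v" for v
    using frac_pos[of v] \<phi>_nonneg[of v]
    by (cases "0 < \<alpha> $ v") (simp_all add: r_def \<phi>_def)
  then have "surge_prices r"
    by (simp add: surge_prices_def)
  moreover have "passenger_taxicab_equilibrium l s d \<alpha> r"
    using complementary_slackness[OF f _ opt]
    by (auto simp: passenger_taxicab_equilibrium_def utility_def r_eq)
  ultimately show ?thesis
    by blast
qed

end
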